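(* Let $X$ be a compact Hausdorff space and $Y$ a real Hilbert space. Let $A:Y\to C(X)$ be linear and bounded, and let $A':C(X)^*\to Y$ denote its adjoint, that is, $\langle\lambda,Ay\rangle=\langle A'\lambda,y\rangle$ for all $\lambda\in C(X)^*$ and $y\in Y$. Then exactly one of the following two statements holds: (1) There exists a nonzero positive $t\in C(X)^*$ such that $A't=0$. (2) There exists a $y\in Y$ such that $Ay>0$.
   Context: $C(X)$ is the real Banach space of continuous functions $X\to\mathbb R$ with the supremum norm and $C(X)^*$ is its dual. An element $t\in C(X)^*$ is positive ($t\ge 0$) if $\langle t,f\rangle\ge 0$ for every $f\in C(X)$ with $f\ge 0$. $Ay>0$ means $(Ay)(x)>0$ for every $x\in X$. The bracket $\langle\cdot,\cdot\rangle$ denotes both the pairing of $C(X)^*$ with $C(X)$ and the inner product of $Y$. *)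

theory Defs
  imports "HOL-Analysis.Analysis"
begin

(* A real Hilbert space is a type of sort {real_inner,complete_space}. On a
   compact space every continuous real function is bounded, so the library type
   'x =>C real of bounded continuous functions is then C(X) with the sup norm. *)

lemma riesz_representation:
  fixes f :: "'a::{real_inner,complete_space} \<Rightarrow> real"
  assumes f: "bounded_linear f"
  shows "\<exists>v. \<forall>y. f y = v \<bullet> y"
proof -
  interpret f: bounded_linear f by (rule f)
  define J where "J v = v \<bullet> v - 2 * f v" for v
  obtain K where K: "\<And>v. norm (f v) \<le> norm v * K"
    using f.bounded by blast
  have lower: "- K\<^sup>2 \<le> J v" for v
  proof -
    have "f v \<le> norm v * K" using K[of v] by auto
    moreover have "0 \<le> (norm v - K)\<^sup>2" by simp
    ultimately show ?thesis
      unfolding J_def dot_square_norm by (simp add: power2_diff)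
  qed
  define m where "m = Inf (range J)"
  have bdd: "bdd_below (range J)" using lower by (auto simp: bdd_below_def)
  have m_le: "m \<le> J v" for v
    unfolding m_def by (rule cInf_lower[OF _ bdd]) auto
  have "\<exists>v. J v < m + 1 / real (Suc n)" for n
  proof -
    have "Inf (range J) < m + 1 / real (Suc n)" unfolding m_def by simp
    then show ?thesis using cInf_less_iff[OF _ bdd] by auto
  qed
  then obtain V where V: "\<And>n. J (V n) < m + 1 / real (Suc n)" by metis
  have para: "(norm (u - v))\<^sup>2 = 2 * (J u + J v - 2 * J ((1/2) *\<^sub>R (u + v)))" for u v
    unfolding J_def power2_norm_eq_inner
    by (simp add: f.add f.scaleR inner_add_left inner_add_right inner_diff_left
        inner_diff_right inner_commute algebra_simps)
  have close: "(norm (V i - V j))\<^sup>2 \<le> 2 * (1 / real (Suc i) + 1 / real (Suc j))" for i j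
  proof -
    have "a + b - 2 * c \<le> x + y" if "a < m + x" "b < m + y" "m \<le> c" for a b c x y :: real
      using that by linarith
    from this[OF V[of i] V[of j] m_le] show ?thesis
      unfolding para by (intro mult_left_mono) auto
  qed
  have "Cauchy V"
  proof (rule metric_CauchyI)
    fix e :: real assume e: "0 < e"
    obtain N where N: "1 / real (Suc N) < e\<^sup>2 / 4"
      using reals_Archimedean[of "e\<^sup>2 / 4"] e by (auto simp: inverse_eq_divide)
    have "dist (V i) (V j) < e" if "i \<ge> N" "j \<ge> N" for i j
    proof -
      have "1 / real (Suc i) \<le> 1 / real (Suc N)" "1 / real (Suc j) \<le> 1 / real (Suc N)"
        using that by (auto simp: frac_le)
      then have "(norm (V i - V j))\<^sup>2 < e\<^sup>2" using close[of i j] N by argo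
      then show ?thesis using e by (simp add: dist_norm power_less_imp_less_base)
    qed
    then show "\<exists>N. \<forall>i\<ge>N. \<forall>j\<ge>N. dist (V i) (V j) < e" by blast
  qed
  then obtain v where v: "V \<longlonglongrightarrow> v" using Cauchy_convergent convergent_def by blast
  have "(\<lambda>n. J (V n)) \<longlonglongrightarrow> J v"
    unfolding J_def by (intro tendsto_intros f.tendsto v)
  moreover have "(\<lambda>n. m + 1 / real (Suc n)) \<longlonglongrightarrow> m + 0"
    by (intro tendsto_intros LIMSEQ_Suc lim_1_over_n)
  ultimately have "J v \<le> m + 0"
    by (rule LIMSEQ_le) (use V less_imp_le in blast)
  then have min: "J v \<le> J w" for w using m_le[of w] by simp
  have "f y = v \<bullet> y" for y
  proof (cases "y = 0")
    case True
    then show ?thesis by (simp add: f.zero)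
  next
    case False
    define q where "q = y \<bullet> y"
    have q: "q > 0" using False by (simp add: q_def)
    define d where "d = v \<bullet> y - f y"
    define t where "t = - d / q"
    have "J (v + t *\<^sub>R y) = J v + 2 * t * d + t * t * q"
      unfolding J_def d_def q_def
      by (simp add: f.add f.scaleR inner_add_left inner_add_right inner_commute algebra_simps)
    moreover have "2 * t * d + t * t * q = - (d * d / q)"
      unfolding t_def using q by (simp add: field_simps)
    ultimately have "d * d / q \<le> 0" using min[of "v + t *\<^sub>R y"] by linarith
    then have "d * d \<le> 0" using q by (simp add: divide_le_0_iff)
    then have "d = 0" using mult_eq_0_iff[of d d] zero_le_square[of d] by linarith
    then show ?thesis by (simp add: d_def)
  qed
  then show ?thesis by blast
qed

(* The adjoint takes values in Y itself, not in its dual: the functional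
   l o A is identified with its Riesz representative. *)
definition adjoint_op ::
  "('y::{real_inner,complete_space} \<Rightarrow>\<^sub>L 'b::real_normed_vector) \<Rightarrow> ('b \<Rightarrow>\<^sub>L real) \<Rightarrow> 'y"
  where "adjoint_op A l = (THE v. \<forall>y. l (A y) = v \<bullet> y)"

lemma adjoint_op:
  fixes A :: "'y::{real_inner,complete_space} \<Rightarrow>\<^sub>L 'b::real_normed_vector"
  shows "blinfun_apply l (blinfun_apply A y) = adjoint_op A l \<bullet> y"
proof -
  have "bounded_linear (\<lambda>y. blinfun_apply l (blinfun_apply A y))"
    by (intro bounded_linear_intros)
  then obtain v where v: "\<forall>y. l (A y) = v \<bullet> y"
    using riesz_representation by blast
  have "\<forall>y. l (A y) = adjoint_op A l \<bullet> y"
    unfolding adjoint_op_def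
  proof (rule theI)
    show "\<forall>y. l (A y) = v \<bullet> y" by (rule v)
    fix w assume "\<forall>y. l (A y) = w \<bullet> y"
    with v have "\<forall>y. w \<bullet> y = v \<bullet> y" by simp
    then show "w = v" using vector_eq_rdot by blast
  qed
  then show ?thesis by blast
qed

definition positive_functional :: "(('x::topological_space \<Rightarrow>\<^sub>C real) \<Rightarrow>\<^sub>L real) \<Rightarrow> bool"
  where "positive_functional t \<longleftrightarrow> (\<forall>f. (\<forall>x. 0 \<le> apply_bcontfun f x) \<longrightarrow> 0 \<le> t f)"

end

theory Submission
  imports Defs
begin

text \<open>The supremum functional on $C(X)$ is sublinear, and it is nonnegative on the range of $A$
  when no \<^term>\<open>A y\<close> is strictly positive. Taking its infimum along cosets of the range gives a
  sublinear functional that still lies below the supremum and is nonpositive on the range. Any linear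
  functional below it (Hahn--Banach) vanishes on the range, and lying below the supremum makes it
  positive, bounded and normalised.\<close>

section \<open>Sublinear functionals on a real vector space\<close>

definition sublinear :: "('a::real_vector \<Rightarrow> real) \<Rightarrow> bool"
  where "sublinear p \<longleftrightarrow>
    (\<forall>f g. p (f + g) \<le> p f + p g) \<and> (\<forall>c f. 0 < c \<longrightarrow> p (c *\<^sub>R f) \<le> c * p f)"

lemma sublinearI:
  assumes "\<And>f g. p (f + g) \<le> p f + p g" and "\<And>c f. 0 < c \<Longrightarrow> p (c *\<^sub>R f) \<le> c * p f"
  shows "sublinear p"
  using assms by (simp add: sublinear_def)

lemma sublinear_add: "sublinear p \<Longrightarrow> p (f + g) \<le> p f + p g"
  by (simp add: sublinear_def)

lemma sublinear_scaleR_le: "sublinear p \<Longrightarrow> 0 < c \<Longrightarrow> p (c *\<^sub>R f) \<le> c * p f"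
  by (simp add: sublinear_def)

lemma sublinear_zero:
  assumes "sublinear p"
  shows "p 0 = 0"
  \<comment> \<open>The factor 2 gives \<open>p 0 \<ge> 0\<close>, the factor 1/2 gives
    \<open>p 0 \<le> 0\<close>.\<close>
  using sublinear_scaleR_le[OF assms, of 2 0] sublinear_scaleR_le[OF assms, of "1/2" 0] by simp

text \<open>Scaling back by \<open>inverse c\<close> reverses the inequality of the definition. This
  is why the definition can ask for \<open>\<le>\<close> alone, which passes easily to
  infima.\<close>

lemma sublinear_scaleR:
  assumes "sublinear p" "0 \<le> c"
  shows "p (c *\<^sub>R f) = c * p f"
proof (cases "c = 0")
  case True
  then show ?thesis by (simp add: sublinear_zero assms)
next
  case False
  with assms have c: "0 < c" by simp
  then have "p (inverse c *\<^sub>R (c *\<^sub>R f)) \<le> inverse c * p (c *\<^sub>R f)"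
    by (intro sublinear_scaleR_le assms) simp
  with c have "c * p f \<le> p (c *\<^sub>R f)" by (simp add: field_simps)
  with sublinear_scaleR_le[OF assms(1) c] show ?thesis by (rule antisym)
qed

lemma sublinear_minus:
  assumes "sublinear p"
  shows "- p (- f) \<le> p f"
  using sublinear_add[OF assms, of f "- f"] sublinear_zero[OF assms] by simp

section \<open>Infimum of a sublinear functional along a convex cone\<close>

text \<open>Under the assumptions of the context that follows, a linear \<open>t\<close> lies below
  \<open>cone_inf p K\<close> exactly when \<open>t \<le> p\<close> and
  \<open>0 \<le> t (fst k) + snd k\<close> for all \<open>k \<in> K\<close>, so each
  \<open>k\<close> encodes an affine constraint on \<open>t\<close>. Offset 0 serves for the range
  of \<open>A\<close>, a nonzero offset for the minimality argument.\<close>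

definition cone_inf :: "('a::real_vector \<Rightarrow> real) \<Rightarrow> ('a \<times> real) set \<Rightarrow> 'a \<Rightarrow> real"
  where "cone_inf p K f = (INF k\<in>K. p (f + fst k) + snd k)"

context
  fixes p :: "'a::real_vector \<Rightarrow> real" and K :: "('a \<times> real) set"
  assumes p: "sublinear p"
    and zero: "0 \<in> K"
    and add: "\<And>k l. k \<in> K \<Longrightarrow> l \<in> K \<Longrightarrow> k + l \<in> K"
    and scale: "\<And>c k. 0 < c \<Longrightarrow> k \<in> K \<Longrightarrow> c *\<^sub>R k \<in> K"
    and nonneg: "\<And>k. k \<in> K \<Longrightarrow> 0 \<le> p (fst k) + snd k"
begin

lemma cone_inf_le:
  assumes "k \<in> K"
  shows "cone_inf p K f \<le> p (f + fst k) + snd k"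
proof -
  \<comment> \<open>Subadditivity at \<open>fst k = (f + fst k) + (- f)\<close> turns
    \<open>nonneg\<close> into a lower bound independent of \<open>k\<close>, so the infimum is a
    genuine one.\<close>
  have "- p (- f) \<le> p (f + fst k) + snd k" if "k \<in> K" for k
    using nonneg[OF that] sublinear_add[OF p, of "f + fst k" "- f"] by simp
  then have "bdd_below ((\<lambda>k. p (f + fst k) + snd k) ` K)"
    by (intro bdd_belowI[of _ "- p (- f)"]) auto
  then show ?thesis
    unfolding cone_inf_def using assms by (rule cINF_lower)
qed

lemma cone_inf_greatest:
  assumes "\<And>k. k \<in> K \<Longrightarrow> b \<le> p (f + fst k) + snd k"
  shows "b \<le> cone_inf p K f"
  unfolding cone_inf_def using zero assms by (intro cINF_greatest) auto

lemma cone_inf_le_self: "cone_inf p K f \<le> p f"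
  using cone_inf_le[OF zero] by simp

text \<open>Competitors \<open>k\<close> for \<open>f\<close> and \<open>l\<close> for
  \<open>g\<close> add up to the competitor \<open>k + l\<close> for \<open>f + g\<close>, and
  scaling a competitor gives homogeneity.\<close>

lemma sublinear_cone_inf: "sublinear (cone_inf p K)"
proof (rule sublinearI)
  fix f g
  have "cone_inf p K (f + g) - cone_inf p K g \<le> p (f + fst k) + snd k" if k: "k \<in> K" for k
  proof -
    \<comment> \<open>The infimum over \<open>l\<close> is taken first, with \<open>k\<close> fixed;
      the outer step then takes it over \<open>k\<close>.\<close>
    have "cone_inf p K (f + g) - (p (f + fst k) + snd k) \<le> p (g + fst l) + snd l"
      if l: "l \<in> K" for l
      using cone_inf_le[OF add[OF k l], of "f + g"]
        sublinear_add[OF p, of "f + fst k" "g + fst l"]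
      by (simp add: algebra_simps)
    from cone_inf_greatest[OF this] show ?thesis by simp
  qed
  from cone_inf_greatest[OF this] show "cone_inf p K (f + g) \<le> cone_inf p K f + cone_inf p K g"
    by simp
next
  fix c :: real and f assume c: "0 < c"
  have "cone_inf p K (c *\<^sub>R f) / c \<le> p (f + fst k) + snd k" if "k \<in> K" for k
    using cone_inf_le[OF scale[OF c that], of "c *\<^sub>R f"]
      sublinear_scaleR[OF p, of c "f + fst k"] c
    by (simp add: scaleR_add_right field_simps)
  from cone_inf_greatest[OF this] show "cone_inf p K (c *\<^sub>R f) \<le> c * cone_inf p K f"
    using c by (simp add: field_simps)
qed

end

section \<open>Minimal sublinear functionals and Hahn-Banach\<close>

text \<open>Testing minimality against the cone spanned by \<open>(g, - q g)\<close> gives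
  \<open>q (- g) \<le> q 0 - q g\<close>.\<close>

lemma minimal_sublinear_imp_linear:
  assumes q: "sublinear q" and min: "\<And>r. sublinear r \<Longrightarrow> r \<le> q \<Longrightarrow> r = q"
  shows "linear q"
proof -
  have minus: "q (- g) = - q g" for g
  proof -
    define K where "K = (\<lambda>s. s *\<^sub>R (g, - q g)) ` {0..}"
    have K: "0 \<in> K" "\<And>k l. k \<in> K \<Longrightarrow> l \<in> K \<Longrightarrow> k + l \<in> K"
        "\<And>c k. 0 < c \<Longrightarrow> k \<in> K \<Longrightarrow> c *\<^sub>R k \<in> K"
        "\<And>k. k \<in> K \<Longrightarrow> 0 \<le> q (fst k) + snd k"
    proof -
      show "0 \<in> K" unfolding K_def by (rule image_eqI[of _ _ 0]) (auto simp: zero_prod_def)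
      show "k + l \<in> K" if kl: "k \<in> K" "l \<in> K" for k l
      proof -
        obtain a b where "0 \<le> a" "0 \<le> b" "k = a *\<^sub>R (g, - q g)" "l = b *\<^sub>R (g, - q g)"
          using kl unfolding K_def by auto
        then show ?thesis
          unfolding K_def by (intro image_eqI[of _ _ "a + b"])
              (auto simp only: scaleR_left_distrib atLeast_iff add_nonneg_nonneg)
      qed
      show "c *\<^sub>R k \<in> K" if c: "0 < c" and k: "k \<in> K" for c k
      proof -
        obtain a where "0 \<le> a" "k = a *\<^sub>R (g, - q g)"
          using k unfolding K_def by auto
        then show ?thesis
          using c unfolding K_def by (intro image_eqI[of _ _ "c * a"]) auto
      qed
      \<comment> \<open>By homogeneity the sum is exactly 0 along this ray.\<close>
      show "0 \<le> q (fst k) + snd k" if "k \<in> K" for k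
        using that unfolding K_def by (auto simp: sublinear_scaleR[OF q])
    qed
    have "cone_inf q K = q"
      by (intro min sublinear_cone_inf[OF q K] le_funI cone_inf_le_self[OF q K])
    moreover have "(g, - q g) \<in> K"
      unfolding K_def by (rule image_eqI[of _ _ 1]) auto
    ultimately have "q (- g) \<le> - q g"
      using cone_inf_le[OF q K, of "(g, - q g)" "- g"] by (simp add: sublinear_zero[OF q])
    with sublinear_minus[OF q, of g] show ?thesis by simp
  qed
  show ?thesis
  proof (rule linearI)
    fix f g
    \<comment> \<open>Since \<open>q\<close> is odd, subadditivity at \<open>- f\<close> and
      \<open>- g\<close> is superadditivity at \<open>f\<close> and \<open>g\<close>.\<close>
    have "- q (f + g) \<le> - q f + - q g"
      using sublinear_add[OF q, of "- f" "- g"] minus[of "f + g"] minus[of f] minus[of g] by simp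
    with sublinear_add[OF q, of f g] show "q (f + g) = q f + q g" by simp
  next
    fix c f
    show "q (c *\<^sub>R f) = c *\<^sub>R q f"
    proof (cases "0 \<le> c")
      case True
      then show ?thesis by (simp add: sublinear_scaleR[OF q])
    next
      case False
      then have "q ((- c) *\<^sub>R f) = - c * q f"
        by (intro sublinear_scaleR[OF q]) simp
      then show ?thesis using minus[of "c *\<^sub>R f"] by simp
    qed
  qed
qed

text \<open>This supplies the bounds for Zorn's lemma: \<open>u\<close> is the pointwise infimum.
  Such an infimum need not be subadditive for an arbitrary family, but in a chain the smaller of two
  members can serve for both arguments.\<close>

lemma sublinear_chain_Inf:
  assumes sub: "\<And>q. q \<in> C \<Longrightarrow> sublinear q" and below: "\<And>q. q \<in> C \<Longrightarrow> q \<le> p"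
    and chain: "\<And>q r. q \<in> C \<Longrightarrow> r \<in> C \<Longrightarrow> q \<le> r \<or> r \<le> q" and ne: "C \<noteq> {}"
  obtains u where "sublinear u" "\<And>q. q \<in> C \<Longrightarrow> u \<le> q"
proof -
  define u where "u f = (INF q\<in>C. q f)" for f
  have bdd: "bdd_below ((\<lambda>q. q f) ` C)" for f
  proof (rule bdd_belowI2)
    fix q assume "q \<in> C"
    \<comment> \<open>The bound is \<open>- p (- f) \<le> - q (- f) \<le> q f\<close>.\<close>
    with sublinear_minus[OF sub] le_funD[OF below]
    show "- p (- f) \<le> q f" by (meson neg_le_iff_le order_trans)
  qed
  have lower: "u f \<le> q f" if "q \<in> C" for q f
    unfolding u_def using bdd that by (rule cINF_lower)
  have greatest: "b \<le> u f" if "\<And>q. q \<in> C \<Longrightarrow> b \<le> q f" for b f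
    unfolding u_def using ne that by (rule cINF_greatest)
  have "sublinear u"
  proof (rule sublinearI)
    fix f g
    have "u (f + g) - u g \<le> q f" if q: "q \<in> C" for q
    proof -
      have "u (f + g) - q f \<le> r g" if r: "r \<in> C" for r
        using chain[OF q r]
      proof
        assume "q \<le> r"
        then show ?thesis
          using lower[OF q, of "f + g"] sublinear_add[OF sub[OF q], of f g] le_funD[of q r g] by simp
      next
        assume "r \<le> q"
        then show ?thesis
          using lower[OF r, of "f + g"] sublinear_add[OF sub[OF r], of f g] le_funD[of r q f] by simp
      qed
      then have "u (f + g) - q f \<le> u g" by (rule greatest)
      then show ?thesis by simp
    qed
    then have "u (f + g) - u g \<le> u f" by (rule greatest)
    then show "u (f + g) \<le> u f + u g" by simp
  next
    fix c :: real and f assume c: "0 < c"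
    have "u (c *\<^sub>R f) / c \<le> q f" if "q \<in> C" for q
      using lower[OF that, of "c *\<^sub>R f"] sublinear_scaleR_le[OF sub[OF that] c, of f] c
      by (simp add: field_simps)
    then have "u (c *\<^sub>R f) / c \<le> u f" by (rule greatest)
    then show "u (c *\<^sub>R f) \<le> c * u f"
      using c by (simp add: field_simps)
  qed
  then show ?thesis using lower by (intro that le_funI)
qed

text \<open>Hahn-Banach with nothing prescribed on a subspace: Zorn's lemma yields a minimal
  sublinear functional below \<open>p\<close>, and minimality makes it linear.\<close>

theorem sublinear_dominates_linear:
  assumes p: "sublinear p"
  obtains t where "linear t" "t \<le> p"
proof -
  define S where "S = {q. sublinear q \<and> q \<le> p}"
  have "\<exists>m\<in>S. \<forall>q\<in>S. q \<le> m \<longrightarrow> q = m"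
  proof (rule predicate_Zorn)
    \<comment> \<open>The order is reversed, so a maximal element is a minimal functional.\<close>
    show "partial_order_on S (relation_of (\<lambda>x y. y \<le> x) S)"
      by (rule partial_order_on_relation_ofI) auto
    fix C assume "C \<in> Chains (relation_of (\<lambda>x y. y \<le> x) S)"
    then have C: "\<And>q. q \<in> C \<Longrightarrow> q \<in> S" "\<And>q r. q \<in> C \<Longrightarrow> r \<in> C \<Longrightarrow> q \<le> r \<or> r \<le> q"
      by (auto simp: Chains_def relation_of_def)
    show "\<exists>u\<in>S. \<forall>q\<in>C. u \<le> q"
    proof (cases "C = {}")
      case True
      then show ?thesis using p by (auto simp: S_def)
    next
      case False
      then obtain q where q: "q \<in> C" by auto
      obtain u where u: "sublinear u" "\<And>q. q \<in> C \<Longrightarrow> u \<le> q"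
        using sublinear_chain_Inf[of C p] C False by (auto simp: S_def)
      have "u \<le> p" using u(2)[OF q] C(1)[OF q] unfolding S_def by (auto intro: order_trans)
      with u show ?thesis by (auto simp: S_def)
    qed
  qed
  then obtain m where "m \<in> S" and m: "\<And>q. q \<in> S \<Longrightarrow> q \<le> m \<Longrightarrow> q = m" by blast
  then have mp: "sublinear m" "m \<le> p" by (auto simp: S_def)
  \<comment> \<open>Minimality within \<open>S\<close> is minimality among all sublinear
    functionals, because whatever lies below \<open>m\<close> lies below \<open>p\<close>.\<close>
  moreover have "r = m" if "sublinear r" "r \<le> m" for r
    using that mp(2) by (intro m) (auto simp: S_def intro: order_trans)
  ultimately show ?thesis
    using that minimal_sublinear_imp_linear by blast
qed

section \<open>The supremum functional\<close>

definition sup_fun :: "('x::topological_space \<Rightarrow>\<^sub>C real) \<Rightarrow> real"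
  where "sup_fun f = (SUP x. f x)"

lemma bdd_above_bcontfun: "bdd_above (range (apply_bcontfun (f :: 'x::topological_space \<Rightarrow>\<^sub>C real)))"
  by (intro bounded_imp_bdd_above bounded_apply_bcontfun)

lemma sup_fun_upper: "apply_bcontfun f x \<le> sup_fun f"
  unfolding sup_fun_def by (intro cSUP_upper bdd_above_bcontfun) auto

lemma sup_fun_least: "(\<And>x. apply_bcontfun f x \<le> b) \<Longrightarrow> sup_fun f \<le> b"
  unfolding sup_fun_def by (intro cSUP_least) auto

lemma sup_fun_le_norm: "sup_fun f \<le> norm f"
  using norm_bounded[of f] by (intro sup_fun_least) (auto simp: abs_le_iff)

lemma sublinear_sup_fun: "sublinear sup_fun"
proof (rule sublinearI)
  show "sup_fun (f + g) \<le> sup_fun f + sup_fun g" for f g :: "'a \<Rightarrow>\<^sub>C real"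
    by (intro sup_fun_least) (simp add: add_mono sup_fun_upper)
  show "sup_fun (c *\<^sub>R f) \<le> c * sup_fun f" if "0 < c" for c and f :: "'a \<Rightarrow>\<^sub>C real"
    using that by (intro sup_fun_least) (simp add: sup_fun_upper)
qed

text \<open>The bound at \<open>f\<close> and \<open>- f\<close> gives continuity with constant 1.
  At the constant -1 it gives \<open>t 1 \<ge> 1\<close>, hence \<open>T \<noteq> 0\<close>. At
  \<open>- f\<close> with \<open>f \<ge> 0\<close> the supremum is at most 0, which gives
  positivity.\<close>

lemma linear_le_sup_fun_imp_positive:
  assumes "linear t" and le: "\<And>f. t f \<le> sup_fun f"
  obtains T where "blinfun_apply T = t" "T \<noteq> 0" "positive_functional T"
proof -
  interpret t: linear t by fact
  have "\<bar>t f\<bar> \<le> norm f" for f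
    using le[of f] le[of "- f"] sup_fun_le_norm[of f] sup_fun_le_norm[of "- f"] t.neg[of f] by simp
  then have T: "blinfun_apply (Blinfun t) = t"
    by (intro bounded_linear_Blinfun_apply bounded_linear_intro[where K=1] t.add t.scale) simp
  moreover have "sup_fun (- const_bcontfun 1 :: 'a \<Rightarrow>\<^sub>C real) \<le> - 1"
    by (rule sup_fun_least) (simp add: const_bcontfun.rep_eq)
  with le[of "- const_bcontfun 1"] have "t (const_bcontfun 1) \<noteq> 0"
    by (auto simp: t.neg)
  with T have "Blinfun t \<noteq> 0" by auto
  moreover have "0 \<le> t f" if "\<And>x. 0 \<le> apply_bcontfun f x" for f
    using le[of "- f"] that sup_fun_least[of "- f" 0] by (simp add: t.neg)
  with T have "positive_functional (Blinfun t)" by (simp add: positive_functional_def)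
  ultimately show ?thesis by (rule that)
qed

section \<open>Positive functionals on bounded continuous functions\<close>

lemma positive_functional_mono:
  assumes "positive_functional t" "\<And>x. apply_bcontfun f x \<le> apply_bcontfun g x"
  shows "t f \<le> t g"
proof -
  have "0 \<le> t (g - f)" using assms unfolding positive_functional_def by simp
  then show ?thesis by (simp add: blinfun.diff_right)
qed

text \<open>Every \<open>f\<close> lies below the constant \<open>norm f\<close>, so a nonpositive
  value at 1 forces \<open>t f \<le> 0\<close> for all \<open>f\<close>; applied to
  \<open>- f\<close> as well, this gives \<open>t = 0\<close>.\<close>

lemma positive_functional_one_pos:
  assumes t: "positive_functional t" "t \<noteq> 0"
  shows "0 < t (const_bcontfun 1)"
proof (rule ccontr)
  assume n: "\<not> 0 < t (const_bcontfun 1)"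
  have le: "t f \<le> 0" for f
  proof -
    have "t f \<le> t (norm f *\<^sub>R const_bcontfun 1)"
      using norm_bounded[of f]
      by (intro positive_functional_mono t) (simp add: const_bcontfun.rep_eq abs_le_iff)
    also have "\<dots> \<le> 0"
      using n by (simp add: blinfun.scaleR_right mult_nonneg_nonpos)
    finally show ?thesis .
  qed
  have "t f = 0" for f
    using le[of f] le[of "- f"] by (simp add: blinfun.minus_right)
  then have "t = 0" by (intro blinfun_eqI) simp
  with t show False by simp
qed

text \<open>By compactness \<open>f\<close> attains its minimum, so it dominates a positive
  constant, on which \<open>t\<close> is positive.\<close>

lemma positive_functional_strict_pos:
  fixes f :: "'x::topological_space \<Rightarrow>\<^sub>C real"
  assumes X: "compact (UNIV :: 'x set)" and t: "positive_functional t" "t \<noteq> 0"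
    and f: "\<And>x. 0 < apply_bcontfun f x"
  shows "0 < t f"
proof -
  have "continuous_on UNIV (apply_bcontfun f)" by (rule continuous_on_apply_bcontfun)
  then obtain a where a: "\<And>x. apply_bcontfun f a \<le> apply_bcontfun f x"
    using continuous_attains_inf[OF X] by auto
  have "0 < f a * t (const_bcontfun 1)"
    using f positive_functional_one_pos[OF t] by simp
  also have "\<dots> = t (f a *\<^sub>R const_bcontfun 1)" by (simp add: blinfun.scaleR_right)
  also have "\<dots> \<le> t f"
    using a by (intro positive_functional_mono t) (simp add: const_bcontfun.rep_eq)
  finally show ?thesis .
qed

section \<open>The two alternatives\<close>

lemma adjoint_op_eq_0_iff: "adjoint_op A l = 0 \<longleftrightarrow> (\<forall>y. blinfun_apply l (blinfun_apply A y) = 0)"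
  unfolding adjoint_op by (metis inner_eq_zero_iff inner_zero_left)

lemma positive_annihilator:
  fixes A :: "'y::real_normed_vector \<Rightarrow>\<^sub>L ('x::topological_space \<Rightarrow>\<^sub>C real)"
  assumes none: "\<nexists>y. \<forall>x. apply_bcontfun (A y) x > 0"
  obtains t where "t \<noteq> 0" "positive_functional t" "\<And>y. blinfun_apply t (A y) = 0"
proof -
  have nonneg: "0 \<le> sup_fun (A y)" for y
  proof -
    \<comment> \<open>A point where \<open>A (- y)\<close> is not positive is one where
      \<open>A y\<close> is nonnegative.\<close>
    obtain x where "apply_bcontfun (A (- y)) x \<le> 0" using none by (meson not_le)
    then show ?thesis
      using sup_fun_upper[of "A y" x] by (simp add: blinfun.minus_right)
  qed
  \<comment> \<open>With zero offsets, the subspace \<open>range A\<close> is a cone whose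
    constraints on \<open>t\<close> read \<open>0 \<le> t (A y)\<close>.\<close>
  define K where "K = (\<lambda>y. (blinfun_apply A y, 0 :: real)) ` UNIV"
  have K: "0 \<in> K" "\<And>k l. k \<in> K \<Longrightarrow> l \<in> K \<Longrightarrow> k + l \<in> K"
      "\<And>c k. 0 < c \<Longrightarrow> k \<in> K \<Longrightarrow> c *\<^sub>R k \<in> K"
      "\<And>k. k \<in> K \<Longrightarrow> 0 \<le> sup_fun (fst k) + snd k"
    unfolding K_def
    by (auto simp: zero_prod_def image_iff nonneg
        simp flip: blinfun.add_right blinfun.scaleR_right intro: exI[of _ 0])
  let ?q = "cone_inf sup_fun K"
  obtain t where t: "linear t" "t \<le> ?q"
    using sublinear_dominates_linear[OF sublinear_cone_inf[OF sublinear_sup_fun K]] .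
  interpret t: linear t by fact
  have le: "t f \<le> sup_fun f" for f
    using le_funD[OF t(2), of f] cone_inf_le_self[OF sublinear_sup_fun K, of f] by simp
  have le0: "t (A y) \<le> 0" for y
  proof -
    \<comment> \<open>Shifting \<open>A y\<close> by \<open>A (- y)\<close> lands at 0, where the
      supremum is 0.\<close>
    have "(A (- y), 0) \<in> K" by (auto simp: K_def)
    from cone_inf_le[OF sublinear_sup_fun K this, of "A y"] le_funD[OF t(2), of "A y"]
    show ?thesis by (simp add: blinfun.minus_right sublinear_zero[OF sublinear_sup_fun])
  qed
  have t0: "t (A y) = 0" for y
    using le0[of y] le0[of "- y"] by (simp add: blinfun.minus_right t.neg)
  obtain T where "blinfun_apply T = t" "T \<noteq> 0" "positive_functional T"
    using linear_le_sup_fun_imp_positive[OF t(1) le] .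
  with t0 show ?thesis by (intro that[of T]) simp_all
qed

theorem theorem4p2:
  fixes A :: "'y::{real_inner,complete_space} \<Rightarrow>\<^sub>L ('x::t2_space \<Rightarrow>\<^sub>C real)"
  assumes "compact (UNIV :: 'x set)"
  shows "(\<exists>t :: ('x \<Rightarrow>\<^sub>C real) \<Rightarrow>\<^sub>L real.
            t \<noteq> 0 \<and> positive_functional t \<and> adjoint_op A t = 0)
         \<longleftrightarrow> \<not> (\<exists>y. \<forall>x. apply_bcontfun (A y) x > 0)"
proof
  \<comment> \<open>The alternatives exclude each other: if \<open>A y\<close> were strictly
    positive, then \<open>t (A y) > 0\<close>, whereas a vanishing adjoint value means
    \<open>t (A y) = 0\<close>.\<close>
  assume "\<exists>t :: ('x \<Rightarrow>\<^sub>C real) \<Rightarrow>\<^sub>L real. t \<noteq> 0 \<and> positive_functional t \<and> adjoint_op A t = 0"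
  then show "\<not> (\<exists>y. \<forall>x. apply_bcontfun (A y) x > 0)"
    using positive_functional_strict_pos[OF assms] by (metis adjoint_op_eq_0_iff less_irrefl)
next
  assume "\<not> (\<exists>y. \<forall>x. apply_bcontfun (A y) x > 0)"
  from positive_annihilator[OF this]
  show "\<exists>t :: ('x \<Rightarrow>\<^sub>C real) \<Rightarrow>\<^sub>L real. t \<noteq> 0 \<and> positive_functional t \<and> adjoint_op A t = 0"
    by (metis adjoint_op_eq_0_iff)
qed

end
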